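(* Let $n,m\geq1$ be integers with $n+m\geq3$, $d=m+n$, and let $\Theta$ be a real $n\times m$ matrix. Then, with the upper Schmidt exponents $\overline\Psi_1,\overline\Psi_2$ defined in the context, \[ \overline\Psi_2\leq\frac{(d-2)\overline\Psi_1}{(n-1)+n\overline\Psi_1}\quad\text{if }\overline\Psi_1\geq\frac{m-n}{2n}, \qquad \overline\Psi_2\leq\frac{(d-2)\overline\Psi_1}{(m-1)-n\overline\Psi_1}\quad\text{if }\overline\Psi_1\leq\frac{m-n}{2n}. \]
   Context: Let $\Lambda=\{(\vec x,\ \vec y-\Theta\vec x)\in\mathbb R^m\times\mathbb R^n:\ \vec x\in\mathbb Z^m,\ \vec y\in\mathbb Z^n\}$, a unimodular lattice in $\mathbb R^d$. For $s>0$ let $\mathcal B(s)=\{\vec z\in\mathbb R^d:\ |z_i|\le e^{s}\ (1\le i\le m),\ |z_i|\le e^{-ms/n}\ (m<i\le d)\}$. For $p=1,\ldots,d$ let $\lambda_p(\mathcal B(s))$ be the $p$-th successive minimum of $\mathcal B(s)$ with respect to $\Lambda$ (the infimum of $\lambda>0$ such that $\lambda\mathcal B(s)$ contains $p$ linearly independent points of $\Lambda$), $\psi_p(s)=\ln(\lambda_p(\mathcal B(s)))/s$, and $\Psi_p(s)=\sum_{i=1}^p\psi_i(s)$. The upper Schmidt exponent is $\overline\Psi_p=\limsup_{s\to+\infty}\Psi_p(s)$. *)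

theory Defs
  imports "HOL-Analysis.Analysis"
begin

text \<open>
  The space of dimension \<open>d = m + n\<close> is the product type \<open>(real ^ 'm) \<times> (real ^ 'n)\<close> with
  \<open>m = CARD('m)\<close> and \<open>n = CARD('n)\<close>: the first \<open>m\<close> coordinates of a point are those of
  its \<^const>\<open>fst\<close>, the last \<open>n\<close> those of its \<^const>\<open>snd\<close>.
\<close>

definition lattice_of :: "real ^ 'm ^ 'n \<Rightarrow> ((real ^ 'm) \<times> (real ^ 'n)) set" where
  "lattice_of \<Theta> = {(x, y - \<Theta> *v x) | x y. (\<forall>i. x $ i \<in> \<int>) \<and> (\<forall>j. y $ j \<in> \<int>)}"

definition box_body :: "real \<Rightarrow> ((real ^ 'm) \<times> (real ^ 'n)) set" where
  "box_body s = {z. (\<forall>i. \<bar>fst z $ i\<bar> \<le> exp s) \<and>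
                    (\<forall>j. \<bar>snd z $ j\<bar> \<le> exp (- (real CARD('m) * s / real CARD('n))))}"

text \<open>
  The infimum is taken in the reals; it is meaningful when the set is nonempty, which is
  the case for a full-rank lattice, a neighbourhood of the origin and \<open>p\<close> at most the
  dimension.
\<close>

definition successive_minimum :: "nat \<Rightarrow> 'a::real_vector set \<Rightarrow> 'a set \<Rightarrow> real" where
  "successive_minimum p B L =
     Inf {l. l > 0 \<and> (\<exists>S. S \<subseteq> L \<inter> (\<lambda>z. l *\<^sub>R z) ` B \<and> finite S \<and> card S = p \<and> independent S)}"

definition psi_fun :: "real ^ 'm ^ 'n \<Rightarrow> nat \<Rightarrow> real \<Rightarrow> real" where
  "psi_fun \<Theta> p s = ln (successive_minimum p (box_body s) (lattice_of \<Theta>)) / s"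

definition Psi_fun :: "real ^ 'm ^ 'n \<Rightarrow> nat \<Rightarrow> real \<Rightarrow> real" where
  "Psi_fun \<Theta> p s = (\<Sum>i=1..p. psi_fun \<Theta> i s)"

definition upper_Schmidt_exponent :: "real ^ 'm ^ 'n \<Rightarrow> nat \<Rightarrow> ereal" where
  "upper_Schmidt_exponent \<Theta> p = Limsup at_top (\<lambda>s. ereal (Psi_fun \<Theta> p s))"

end

theory Submission
  imports Defs
begin

text \<open>
  Let \<open>L\<close> be the logarithm of the first minimum, attained at \<open>s\<close> (up to a constant) by a lattice vector
  \<open>v\<close>, let \<open>V u\<close> be the logarithm of the norm of \<open>v\<close> with respect to the box at \<open>u\<close>, and \<open>M u\<close> the
  logarithm of the least norm of a lattice vector independent of \<open>v\<close>. On one side of \<open>s\<close> the function \<open>V\<close> is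
  linear with slope \<open>-1\<close> or \<open>m / n\<close>, while the slopes of \<open>M\<close> lie between these two numbers. Following
  \<open>V\<close> uphill from \<open>s\<close> one reaches a point \<open>t\<close> where \<open>V\<close> meets \<open>M\<close>; there both are
  at most \<open>P t\<close> for any \<open>P\<close> above the first exponent. Going back to \<open>s\<close> this bounds \<open>V s + M s\<close> in two
  ways: through the slopes, and through \<open>V s + (d - 1) M s \<le> O(1)\<close>, a weak form of Minkowski's second
  theorem. Either the first bound suffices, or a convex combination of both, chosen so that the
  result depends on \<open>s\<close> only, gives the claim.
\<close>

section \<open>Box norms and successive minima\<close>

text \<open>The Minkowski functional of \<open>box_body s\<close>: membership in a dilate of the box
  becomes an upper bound on this norm.\<close>

definition box_norm :: "real \<Rightarrow> (real ^ 'm) \<times> (real ^ 'n) \<Rightarrow> real" where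
  "box_norm s z = max (exp (- s) * infnorm (fst z))
                      (exp (real CARD('m) * s / real CARD('n)) * infnorm (snd z))"

lemma infnorm_cart_le_iff: "infnorm (x :: real ^ 'n) \<le> c \<longleftrightarrow> (\<forall>i. \<bar>x $ i\<bar> \<le> c)"
proof
  assume "\<forall>i. \<bar>x $ i\<bar> \<le> c"
  then show "infnorm x \<le> c"
    unfolding infnorm_cart by (intro cSup_least) auto
next
  assume "infnorm x \<le> c"
  then show "\<forall>i. \<bar>x $ i\<bar> \<le> c"
    using component_le_infnorm_cart order_trans by blast
qed

lemma infnorm_cart_less_iff: "infnorm (x :: real ^ 'n) < c \<longleftrightarrow> (\<forall>i. \<bar>x $ i\<bar> < c)"
proof
  assume *: "\<forall>i. \<bar>x $ i\<bar> < c"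
  have "{\<bar>x $ i\<bar> |i. i \<in> UNIV} = range (\<lambda>i. \<bar>x $ i\<bar>)" by auto
  then show "infnorm x < c"
    unfolding infnorm_cart using * by (subst cSup_eq_Max) auto
next
  assume "infnorm x < c"
  then show "\<forall>i. \<bar>x $ i\<bar> < c"
    using component_le_infnorm_cart le_less_trans by blast
qed

lemma box_norm_nonneg: "0 \<le> box_norm s z"
  by (simp add: box_norm_def le_max_iff_disj infnorm_pos_le)

lemma box_norm_le_iff:
  fixes z :: "(real ^ 'm) \<times> (real ^ 'n)"
  shows "box_norm s z \<le> l \<longleftrightarrow> (\<forall>i. \<bar>fst z $ i\<bar> \<le> l * exp s) \<and>
           (\<forall>j. \<bar>snd z $ j\<bar> \<le> l * exp (- (real CARD('m) * s / real CARD('n))))"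
proof -
  have "exp (- s) * infnorm (fst z) \<le> l \<longleftrightarrow> infnorm (fst z) \<le> l * exp s"
    by (simp add: exp_minus field_simps)
  moreover have "exp (real CARD('m) * s / real CARD('n)) * infnorm (snd z) \<le> l \<longleftrightarrow>
      infnorm (snd z) \<le> l * exp (- (real CARD('m) * s / real CARD('n)))"
    unfolding exp_minus by (simp add: field_simps)
  ultimately show ?thesis
    unfolding box_norm_def by (simp add: infnorm_cart_le_iff)
qed

lemma box_norm_less_iff:
  fixes z :: "(real ^ 'm) \<times> (real ^ 'n)"
  shows "box_norm s z < l \<longleftrightarrow> (\<forall>i. \<bar>fst z $ i\<bar> < l * exp s) \<and>
           (\<forall>j. \<bar>snd z $ j\<bar> < l * exp (- (real CARD('m) * s / real CARD('n))))"
proof -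
  have "exp (- s) * infnorm (fst z) < l \<longleftrightarrow> infnorm (fst z) < l * exp s"
    by (simp add: exp_minus field_simps)
  moreover have "exp (real CARD('m) * s / real CARD('n)) * infnorm (snd z) < l \<longleftrightarrow>
      infnorm (snd z) < l * exp (- (real CARD('m) * s / real CARD('n)))"
    unfolding exp_minus by (simp add: field_simps)
  ultimately show ?thesis
    unfolding box_norm_def by (simp add: infnorm_cart_less_iff)
qed

lemma mem_scaled_box_body_iff:
  fixes z :: "(real ^ 'm) \<times> (real ^ 'n)"
  assumes "l > 0"
  shows "z \<in> (\<lambda>z. l *\<^sub>R z) ` box_body s \<longleftrightarrow> box_norm s z \<le> l"
proof
  assume "z \<in> (\<lambda>z. l *\<^sub>R z) ` box_body s"
  then show "box_norm s z \<le> l"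
    using assms by (auto simp: box_norm_le_iff box_body_def abs_mult)
next
  assume *: "box_norm s z \<le> l"
  have "inverse l *\<^sub>R z \<in> box_body s"
    using * assms by (auto simp: box_norm_le_iff box_body_def abs_mult field_simps)
  moreover have "z = l *\<^sub>R (inverse l *\<^sub>R z)"
    using assms by simp
  ultimately show "z \<in> (\<lambda>z. l *\<^sub>R z) ` box_body s"
    by blast
qed

lemma box_norm_scaleR: "box_norm s (c *\<^sub>R z) = \<bar>c\<bar> * box_norm s z"
  by (simp add: box_norm_def infnorm_mul max_mult_distrib_left mult.left_commute)

text \<open>Passing from \<open>s\<close> to \<open>s + h\<close> shrinks the first term of the
  maximum and enlarges the second. Logarithms of norms thus have slopes between -1 and m/n; this
  lemma and the next give the two bounds.\<close>

lemma box_norm_forward: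
  fixes z :: "(real ^ 'm) \<times> (real ^ 'n)"
  assumes "h \<ge> 0"
  shows "box_norm (s + h) z \<le> exp (real CARD('m) / real CARD('n) * h) * box_norm s z"
proof -
  have "exp (- (s + h)) * infnorm (fst z) \<le> 1 * (exp (- s) * infnorm (fst z))"
    using assms by (simp add: infnorm_pos_le mult_right_mono)
  also have "\<dots> \<le> exp (real CARD('m) / real CARD('n) * h) * box_norm s z"
    by (intro mult_mono) (use assms in \<open>auto simp: box_norm_def infnorm_pos_le\<close>)
  finally have 1: "exp (- (s + h)) * infnorm (fst z) \<le> exp (real CARD('m) / real CARD('n) * h) * box_norm s z" .
  have "exp (real CARD('m) * (s + h) / real CARD('n)) * infnorm (snd z) =
      exp (real CARD('m) / real CARD('n) * h) * (exp (real CARD('m) * s / real CARD('n)) * infnorm (snd z))"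
    by (simp add: mult_exp_exp add_divide_distrib distrib_left add.commute flip: mult.assoc)
  also have "\<dots> \<le> exp (real CARD('m) / real CARD('n) * h) * box_norm s z"
    by (intro mult_left_mono) (auto simp: box_norm_def)
  finally show ?thesis
    using 1 by (subst box_norm_def) simp
qed

lemma box_norm_backward:
  fixes z :: "(real ^ 'm) \<times> (real ^ 'n)"
  assumes "h \<ge> 0"
  shows "box_norm s z \<le> exp h * box_norm (s + h) z"
proof -
  have "exp (- s) * infnorm (fst z) = exp h * (exp (- (s + h)) * infnorm (fst z))"
    by (simp add: mult_exp_exp flip: mult.assoc)
  also have "\<dots> \<le> exp h * box_norm (s + h) z"
    by (intro mult_left_mono) (auto simp: box_norm_def)
  finally have 1: "exp (- s) * infnorm (fst z) \<le> exp h * box_norm (s + h) z" .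
  have "exp (real CARD('m) * s / real CARD('n)) * infnorm (snd z) \<le>
      1 * (exp (real CARD('m) * (s + h) / real CARD('n)) * infnorm (snd z))"
    using assms by (auto intro!: mult_right_mono divide_right_mono mult_left_mono simp: infnorm_pos_le)
  also have "\<dots> \<le> exp h * box_norm (s + h) z"
    by (intro mult_mono) (use assms in \<open>auto simp: box_norm_def infnorm_pos_le\<close>)
  finally show ?thesis
    using 1 by (subst box_norm_def) simp
qed

text \<open>Going left, the first term grows at the largest rate that
  \<open>box_norm_backward\<close> permits, so it stays the maximum once it is.\<close>

lemma box_norm_fst_dominant_backward:
  fixes z :: "(real ^ 'm) \<times> (real ^ 'n)"
  assumes "box_norm (s + h) z = exp (- (s + h)) * infnorm (fst z)" "h \<ge> 0"
  shows "box_norm s z = exp h * box_norm (s + h) z"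
proof (rule antisym)
  have "exp h * box_norm (s + h) z = exp (- s) * infnorm (fst z)"
    unfolding assms(1) by (simp add: mult_exp_exp flip: mult.assoc)
  then show "exp h * box_norm (s + h) z \<le> box_norm s z"
    by (simp add: box_norm_def)
qed (rule box_norm_backward[OF assms(2)])

lemma box_norm_snd_dominant_forward:
  fixes z :: "(real ^ 'm) \<times> (real ^ 'n)"
  assumes "box_norm s z = exp (real CARD('m) * s / real CARD('n)) * infnorm (snd z)" "h \<ge> 0"
  shows "box_norm (s + h) z = exp (real CARD('m) / real CARD('n) * h) * box_norm s z"
proof (rule antisym)
  have "exp (real CARD('m) / real CARD('n) * h) * box_norm s z =
        exp (real CARD('m) * (s + h) / real CARD('n)) * infnorm (snd z)"
    unfolding assms(1)
    by (simp add: mult_exp_exp add_divide_distrib distrib_left add.commute flip: mult.assoc)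
  then show "exp (real CARD('m) / real CARD('n) * h) * box_norm s z \<le> box_norm (s + h) z"
    by (simp add: box_norm_def)
qed (rule box_norm_forward[OF assms(2)])

section \<open>Lattice vectors and their norms\<close>

lemma diff_mem_lattice_of:
  assumes "z \<in> lattice_of \<Theta>" "w \<in> lattice_of \<Theta>"
  shows "z - w \<in> lattice_of \<Theta>"
proof -
  obtain x y x' y' where "z = (x, y - \<Theta> *v x)" "w = (x', y' - \<Theta> *v x')"
    "\<forall>i. x $ i \<in> \<int>" "\<forall>j. y $ j \<in> \<int>" "\<forall>i. x' $ i \<in> \<int>" "\<forall>j. y' $ j \<in> \<int>"
    using assms unfolding lattice_of_def by blast
  then show ?thesis
    unfolding lattice_of_def mem_Collect_eq
    by (intro exI[of _ "x - x'"] exI[of _ "y - y'"]) (auto simp: matrix_vector_mult_diff_distrib)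
qed

lemma infnorm_integral_ge_1:
  fixes x :: "real ^ 'n"
  assumes "\<forall>i. x $ i \<in> \<int>" "x \<noteq> 0"
  shows "infnorm x \<ge> 1"
proof -
  obtain i where "x $ i \<noteq> 0"
    using assms(2) by (auto simp: vec_eq_iff)
  then have "\<bar>x $ i\<bar> \<ge> 1"
    using assms(1) Ints_nonzero_abs_ge1 by blast
  then show ?thesis
    using component_le_infnorm_cart[of x i] by linarith
qed

text \<open>Discreteness of the lattice: a nonzero integer vector \<open>x\<close> gives a first
  block of sup norm at least 1; if \<open>x\<close> vanishes, the second block is the nonzero
  integer vector \<open>y\<close>.\<close>

lemma box_norm_lattice_ge:
  fixes \<Theta> :: "real ^ 'm ^ 'n"
  assumes "w \<in> lattice_of \<Theta> - {0}"
  shows "min (exp (- s)) (exp (real CARD('m) * s / real CARD('n))) \<le> box_norm s w"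
proof -
  obtain x y where w: "w = (x, y - \<Theta> *v x)" "\<forall>i. x $ i \<in> \<int>" "\<forall>j. y $ j \<in> \<int>"
    using assms unfolding lattice_of_def by blast
  show ?thesis
  proof (cases "x = 0")
    case True
    then have "y \<noteq> 0" using assms w by (auto simp: zero_prod_def)
    then show ?thesis
      using infnorm_integral_ge_1[of y] w True
      by (auto simp: box_norm_def min_le_iff_disj le_max_iff_disj)
  next
    case False
    then show ?thesis
      using infnorm_integral_ge_1[of x] w
      by (auto simp: box_norm_def min_le_iff_disj le_max_iff_disj)
  qed
qed

lemma box_norm_lattice_ge_exp:
  fixes \<Theta> :: "real ^ 'm ^ 'n"
  assumes "w \<in> lattice_of \<Theta> - {0}" "s \<ge> 0"
  shows "exp (- s) \<le> box_norm s w"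
proof -
  have "- s \<le> 0" "0 \<le> real CARD('m) * s / real CARD('n)"
    using assms(2) by auto
  then have "exp (- s) \<le> exp (real CARD('m) * s / real CARD('n))"
    unfolding exp_le_cancel_iff by (rule order_trans)
  then show ?thesis using box_norm_lattice_ge[OF assms(1), of s] by simp
qed

text \<open>If \<open>fst v\<close> is nonzero, a unit vector in the second block lies off the line
  through \<open>v\<close>. Otherwise a lattice point over a unit vector \<open>x\<close> does, and
  rounding keeps its second block small.\<close>

lemma exists_independent_lattice_vector:
  fixes \<Theta> :: "real ^ 'm ^ 'n"
  assumes "v \<noteq> 0" "s \<ge> 0"
  shows "\<exists>w \<in> lattice_of \<Theta> - span {v}. box_norm s w \<le> exp (real CARD('m) * s / real CARD('n))"
proof (cases "fst v = 0")
  case False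
  define w :: "(real ^ 'm) \<times> (real ^ 'n)" where "w = (0, axis undefined 1)"
  have "w \<in> lattice_of \<Theta>"
    unfolding lattice_of_def w_def mem_Collect_eq
    by (intro exI[of _ 0] exI[of _ "axis undefined 1"]) (auto simp: axis_def)
  moreover have "w \<notin> span {v}"
  proof
    assume "w \<in> span {v}"
    then obtain c where "w = c *\<^sub>R v" by (auto simp: span_singleton)
    then have "c = 0" using False by (auto simp: w_def prod_eq_iff)
    then show False using \<open>w = c *\<^sub>R v\<close> by (simp add: w_def prod_eq_iff)
  qed
  moreover have "infnorm (axis undefined 1 :: real ^ 'n) \<le> 1"
    by (auto simp: infnorm_cart_le_iff axis_def)
  ultimately show ?thesis
    by (intro bexI[of _ w]) (auto simp: box_norm_def w_def infnorm_0)
next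
  case True
  define x :: "real ^ 'm" where "x = axis undefined 1"
  define y :: "real ^ 'n" where "y = (\<chi> j. of_int \<lceil>(\<Theta> *v x) $ j\<rceil>)"
  define w where "w = (x, y - \<Theta> *v x)"
  have "w \<in> lattice_of \<Theta>"
    unfolding lattice_of_def w_def mem_Collect_eq
    by (intro exI[of _ x] exI[of _ y]) (auto simp: x_def y_def axis_def)
  moreover have "w \<notin> span {v}"
  proof
    assume "w \<in> span {v}"
    then obtain c where "w = c *\<^sub>R v" by (auto simp: span_singleton)
    then show False using True by (simp add: w_def x_def prod_eq_iff)
  qed
  moreover have "infnorm x \<le> 1"
    by (auto simp: infnorm_cart_le_iff x_def axis_def)
  moreover have "infnorm (y - \<Theta> *v x) \<le> 1"
  proof -
    have "\<bar>of_int \<lceil>a\<rceil> - a\<bar> \<le> 1" for a :: real by linarith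
    then show ?thesis by (auto simp: infnorm_cart_le_iff y_def)
  qed
  moreover have "exp (- s) * infnorm x \<le> exp (real CARD('m) * s / real CARD('n))"
  proof -
    have "exp (- s) * infnorm x \<le> 1 * 1"
      using assms \<open>infnorm x \<le> 1\<close> by (intro mult_mono) (auto simp: infnorm_pos_le)
    also have "1 * 1 \<le> exp (real CARD('m) * s / real CARD('n))"
      using assms by simp
    finally show ?thesis .
  qed
  ultimately show ?thesis
    by (intro bexI[of _ w]) (auto simp: box_norm_def w_def)
qed

section \<open>The first minimum and the minimum off a line\<close>

definition first_minimum :: "real ^ 'm ^ 'n \<Rightarrow> real \<Rightarrow> real" where
  "first_minimum \<Theta> s = (INF w \<in> lattice_of \<Theta> - {0}. box_norm s w)"

text \<open>A substitute for the second minimum, tied to a vector \<open>v\<close> that is chosen at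
  one parameter and kept while the parameter moves.\<close>

definition transverse_minimum ::
    "real ^ 'm ^ 'n \<Rightarrow> (real ^ 'm) \<times> (real ^ 'n) \<Rightarrow> real \<Rightarrow> real" where
  "transverse_minimum \<Theta> v s = (INF w \<in> lattice_of \<Theta> - span {v}. box_norm s w)"

lemma lattice_minus_span_subset: "lattice_of \<Theta> - span {v} \<subseteq> lattice_of \<Theta> - {0}"
  by (auto simp: span_zero)

lemma lattice_minus_span_nonempty: "v \<noteq> 0 \<Longrightarrow> lattice_of \<Theta> - span {v} \<noteq> {}"
  using exists_independent_lattice_vector[of v 0 \<Theta>] by blast

lemma lattice_minus_zero_nonempty:
  fixes \<Theta> :: "real ^ 'm ^ 'n"
  shows "lattice_of \<Theta> - {0} \<noteq> {}"
proof -
  have "(axis undefined 1, 0) \<noteq> (0 :: (real ^ 'm) \<times> (real ^ 'n))"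
    by (simp add: prod_eq_iff)
  from lattice_minus_span_nonempty[OF this, of \<Theta>] show ?thesis
    using lattice_minus_span_subset by blast
qed

lemma bdd_below_box_norm: "bdd_below (box_norm s ` A)"
  by (intro bdd_belowI2[of _ 0]) (rule box_norm_nonneg)

lemma first_minimum_le: "w \<in> lattice_of \<Theta> - {0} \<Longrightarrow> first_minimum \<Theta> s \<le> box_norm s w"
  unfolding first_minimum_def by (rule cINF_lower[OF bdd_below_box_norm])

lemma transverse_minimum_le:
  "w \<in> lattice_of \<Theta> - span {v} \<Longrightarrow> transverse_minimum \<Theta> v s \<le> box_norm s w"
  unfolding transverse_minimum_def by (rule cINF_lower[OF bdd_below_box_norm])

lemma first_minimum_le_transverse:
  "v \<noteq> 0 \<Longrightarrow> first_minimum \<Theta> s \<le> transverse_minimum \<Theta> v s"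
  unfolding first_minimum_def transverse_minimum_def
  by (intro cINF_superset_mono lattice_minus_span_nonempty bdd_below_box_norm
      lattice_minus_span_subset) auto

lemma first_minimum_pos: "0 < first_minimum \<Theta> s"
proof -
  let ?c = "min (exp (- s)) (exp (real CARD('a) * s / real CARD('b)))"
  have "?c \<le> first_minimum \<Theta> s"
    unfolding first_minimum_def
    by (rule cINF_greatest[OF lattice_minus_zero_nonempty box_norm_lattice_ge])
  moreover have "0 < ?c" by simp
  ultimately show ?thesis by (rule less_le_trans[rotated])
qed

lemma transverse_minimum_pos: "v \<noteq> 0 \<Longrightarrow> 0 < transverse_minimum \<Theta> v s"
  using first_minimum_pos first_minimum_le_transverse by (rule less_le_trans)

lemma exp_le_first_minimum: "s \<ge> 0 \<Longrightarrow> exp (- s) \<le> first_minimum \<Theta> s"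
  unfolding first_minimum_def
  by (rule cINF_greatest[OF lattice_minus_zero_nonempty box_norm_lattice_ge_exp])

lemma transverse_minimum_le_exp:
  fixes \<Theta> :: "real ^ 'm ^ 'n"
  assumes "v \<noteq> 0" "s \<ge> 0"
  shows "transverse_minimum \<Theta> v s \<le> exp (real CARD('m) * s / real CARD('n))"
  using exists_independent_lattice_vector[OF assms, of \<Theta>] transverse_minimum_le order_trans by blast

section \<open>Comparison with the successive minima\<close>

lemma independent_pair_iff:
  fixes v w :: "'a :: real_vector"
  assumes "v \<noteq> 0"
  shows "independent {v, w} \<and> v \<noteq> w \<longleftrightarrow> w \<notin> span {v}"
  using assms independent_insert[of w "{v}"] by (auto simp: insert_commute span_base)

text \<open>The admissible dilations form the upward closure of the set of norms of nonzero lattice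
  vectors, which does not change the infimum.\<close>

lemma successive_minimum_1:
  "successive_minimum 1 (box_body s) (lattice_of \<Theta>) = first_minimum \<Theta> s"
proof -
  let ?X = "{l. l > 0 \<and> (\<exists>S. S \<subseteq> lattice_of \<Theta> \<inter> (\<lambda>z. l *\<^sub>R z) ` box_body s \<and>
                  finite S \<and> card S = 1 \<and> independent S)}"
  have X: "?X = {l. \<exists>w \<in> lattice_of \<Theta> - {0}. box_norm s w \<le> l}" (is "_ = ?Y")
  proof safe
    fix l S assume l: "0 < l" and S: "S \<subseteq> lattice_of \<Theta> \<inter> (\<lambda>z. l *\<^sub>R z) ` box_body s"
      "card S = 1" "independent S"
    obtain w where "S = {w}" using S(2) by (auto simp: card_1_singleton_iff)
    then show "\<exists>w \<in> lattice_of \<Theta> - {0}. box_norm s w \<le> l"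
      using S mem_scaled_box_body_iff[OF l, of w s] dependent_single by (intro bexI[of _ w]) auto
  next
    fix l w assume w: "w \<in> lattice_of \<Theta>" "w \<noteq> 0" "box_norm s w \<le> l"
    then show l: "0 < l"
      using first_minimum_pos[of \<Theta> s] first_minimum_le[of w \<Theta> s] by auto
    show "\<exists>S. S \<subseteq> lattice_of \<Theta> \<inter> (\<lambda>z. l *\<^sub>R z) ` box_body s \<and> finite S \<and> card S = 1 \<and> independent S"
      using w mem_scaled_box_body_iff[OF l, of w s] by (intro exI[of _ "{w}"]) auto
  qed
  have "Inf ?Y = first_minimum \<Theta> s"
    unfolding first_minimum_def
  proof (rule antisym)
    show "Inf ?Y \<le> (INF w \<in> lattice_of \<Theta> - {0}. box_norm s w)"
    proof (rule cINF_greatest[OF lattice_minus_zero_nonempty])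
      fix w assume "w \<in> lattice_of \<Theta> - {0}"
      then show "Inf ?Y \<le> box_norm s w"
        by (intro cInf_lower bdd_belowI[of _ 0]) (auto intro: order_trans[OF box_norm_nonneg])
    qed
    show "(INF w \<in> lattice_of \<Theta> - {0}. box_norm s w) \<le> Inf ?Y"
    proof (rule cInf_greatest)
      show "?Y \<noteq> {}" using lattice_minus_zero_nonempty[of \<Theta>] by blast
      fix l assume "l \<in> ?Y"
      then obtain w where "w \<in> lattice_of \<Theta> - {0}" "box_norm s w \<le> l" by blast
      then show "(INF w \<in> lattice_of \<Theta> - {0}. box_norm s w) \<le> l"
        by (rule cINF_lower2[OF bdd_below_box_norm])
    qed
  qed
  then show ?thesis unfolding successive_minimum_def X .
qed

text \<open>Each lattice vector \<open>w\<close> off the line through \<open>v\<close> makes the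
  larger of the two norms an admissible dilation. Positivity, wanted for logarithms, follows from
  comparison with the first minimum.\<close>

lemma successive_minimum_2_pos_le:
  assumes v: "v \<in> lattice_of \<Theta> - {0}"
  shows "0 < successive_minimum 2 (box_body s) (lattice_of \<Theta>)"
    and "successive_minimum 2 (box_body s) (lattice_of \<Theta>)
           \<le> max (box_norm s v) (transverse_minimum \<Theta> v s)"
proof -
  let ?X = "{l. l > 0 \<and> (\<exists>S. S \<subseteq> lattice_of \<Theta> \<inter> (\<lambda>z. l *\<^sub>R z) ` box_body s \<and>
                  finite S \<and> card S = 2 \<and> independent S)}"
  have mem: "max (box_norm s v) (box_norm s w) \<in> ?X" if w: "w \<in> lattice_of \<Theta> - span {v}" for w
  proof -
    define l where "l = max (box_norm s v) (box_norm s w)"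
    have l: "l > 0"
      using first_minimum_pos[of \<Theta> s] first_minimum_le[OF v, of s] by (simp add: l_def less_max_iff_disj)
    have "independent {v, w}" "v \<noteq> w" using independent_pair_iff[of v w] v w by auto
    then show ?thesis
      unfolding l_def[symmetric] using l v w mem_scaled_box_body_iff[OF l, of v s] mem_scaled_box_body_iff[OF l, of w s]
      by (auto intro!: exI[of _ "{v, w}"] simp: l_def)
  qed
  have lower: "first_minimum \<Theta> s \<le> l" if "l \<in> ?X" for l
  proof -
    from that obtain S where l: "l > 0" and S: "S \<subseteq> lattice_of \<Theta> \<inter> (\<lambda>z. l *\<^sub>R z) ` box_body s"
      "card S = 2" "independent S" by blast
    then obtain w where w: "w \<in> S" by (metis card.empty ex_in_conv zero_neq_numeral)
    then have "w \<noteq> 0" using S dependent_zero by blast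
    moreover have "w \<in> lattice_of \<Theta>" "w \<in> (\<lambda>z. l *\<^sub>R z) ` box_body s" using S(1) w by blast+
    ultimately have "first_minimum \<Theta> s \<le> box_norm s w" "box_norm s w \<le> l"
      using mem_scaled_box_body_iff[OF l] by (blast intro: first_minimum_le)+
    then show ?thesis by (rule order_trans)
  qed
  obtain w\<^sub>0 where "w\<^sub>0 \<in> lattice_of \<Theta> - span {v}"
    using lattice_minus_span_nonempty[of v \<Theta>] v by auto
  from mem[OF this] have ne: "?X \<noteq> {}" by (metis empty_iff)
  have "first_minimum \<Theta> s \<le> Inf ?X" by (rule cInf_greatest[OF ne lower])
  then show "0 < successive_minimum 2 (box_body s) (lattice_of \<Theta>)"
    unfolding successive_minimum_def using first_minimum_pos[of \<Theta> s] by linarith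
  show "successive_minimum 2 (box_body s) (lattice_of \<Theta>)
           \<le> max (box_norm s v) (transverse_minimum \<Theta> v s)"
  proof (rule ccontr)
    assume "\<not> ?thesis"
    then have *: "box_norm s v < Inf ?X" "transverse_minimum \<Theta> v s < Inf ?X"
      unfolding successive_minimum_def by auto
    from *(2) obtain w where w: "w \<in> lattice_of \<Theta> - span {v}" "box_norm s w < Inf ?X"
      unfolding transverse_minimum_def
      using cINF_less_iff[OF lattice_minus_span_nonempty bdd_below_box_norm] v by blast
    have "Inf ?X \<le> max (box_norm s v) (box_norm s w)"
      by (rule cInf_lower[OF mem[OF w(1)] bdd_belowI[OF lower]])
    then show False using *(1) w(2) by linarith
  qed
qed

section \<open>A weak form of Minkowski's second theorem\<close>

lemma card_le_card_times_fibre_bound: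
  assumes "finite A" "finite B" "c ` A \<subseteq> B"
    and "\<And>y. y \<in> B \<Longrightarrow> real (card {x \<in> A. c x = y}) \<le> k"
  shows "real (card A) \<le> real (card B) * k"
proof -
  have "card A = (\<Sum>y\<in>B. card {x \<in> A. c x = y})"
    using sum.group[OF assms(1-3), of "\<lambda>_. 1 :: nat"] by simp
  also have "real \<dots> \<le> (\<Sum>y\<in>B. k)"
    unfolding of_nat_sum by (rule sum_mono[OF assms(4)])
  finally show ?thesis by simp
qed

text \<open>Distinct elements have distinct floors, and at most \<open>2 * r + 2\<close> integers
  are available, which is at most \<open>4 * r\<close> as \<open>r\<close> is at least 1.\<close>

lemma card_le_of_separated_reals:
  fixes c :: "'a \<Rightarrow> real"
  assumes bound: "\<And>x. x \<in> F \<Longrightarrow> \<bar>c x\<bar> \<le> r" and r: "r \<ge> 1"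
    and sep: "\<And>x y. x \<in> F \<Longrightarrow> y \<in> F \<Longrightarrow> x \<noteq> y \<Longrightarrow> \<bar>c x - c y\<bar> \<ge> 1"
  shows "real (card F) \<le> 4 * r"
proof -
  have "inj_on (\<lambda>x. \<lfloor>c x\<rfloor>) F"
  proof (rule inj_onI, rule ccontr)
    fix x y assume "x \<in> F" "y \<in> F" "\<lfloor>c x\<rfloor> = \<lfloor>c y\<rfloor>" "x \<noteq> y"
    then show False using sep[of x y] by linarith
  qed
  moreover have "(\<lambda>x. \<lfloor>c x\<rfloor>) ` F \<subseteq> {\<lfloor>- r\<rfloor>..\<lfloor>r\<rfloor>}"
  proof clarsimp
    fix x assume "x \<in> F"
    from bound[OF this] show "\<lfloor>- r\<rfloor> \<le> \<lfloor>c x\<rfloor> \<and> \<lfloor>c x\<rfloor> \<le> \<lfloor>r\<rfloor>"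
      by (intro conjI floor_mono) auto
  qed
  ultimately have "card F \<le> card {\<lfloor>- r\<rfloor>..\<lfloor>r\<rfloor>}"
    by (rule card_inj_on_le) simp
  then show ?thesis using r by simp linarith
qed

text \<open>
  Weak form of Minkowski's second theorem. The lattice points \<open>(x, y - \<Theta> x)\<close> with \<open>x\<close> in a cube and
  last coordinates in \<open>[0, 1)\<close> are sorted into cells so small that two points in one cell differ by a
  vector of norm less than the transverse minimum, hence by a multiple of \<open>v\<close>.
\<close>
lemma first_minimum_times_transverse_minimum_power_le:
  fixes \<Theta> :: "real ^ 'm ^ 'n"
  assumes v: "v \<in> lattice_of \<Theta> - {0}" and s: "s \<ge> 0"
  shows "first_minimum \<Theta> s * transverse_minimum \<Theta> v s ^ (CARD('m) + CARD('n) - 1) \<le> 2 ^ (CARD('n) + 2)"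
proof -
  define l where "l = first_minimum \<Theta> s"
  define \<mu> where "\<mu> = transverse_minimum \<Theta> v s"
  \<comment> \<open>\<open>Q\<close> and \<open>\<delta>\<close> are the half side lengths of the
    box dilated by \<open>\<mu>\<close>.\<close>
  define Q where "Q = \<mu> * exp s"
  define \<delta> where "\<delta> = \<mu> * exp (- (real CARD('m) * s / real CARD('n)))"
  define K where "K = nat \<lceil>Q\<rceil>"
  define N where "N = nat \<lceil>1 / \<delta>\<rceil>"
  have v0: "v \<noteq> 0" using v by simp
  have l: "l > 0" unfolding l_def by (rule first_minimum_pos)
  have l\<mu>: "l \<le> \<mu>" unfolding l_def \<mu>_def by (rule first_minimum_le_transverse[OF v0])
  have \<mu>: "\<mu> > 0" using l l\<mu> by simp
  have \<delta>: "\<delta> > 0" using \<mu> by (simp add: \<delta>_def)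
  have Q: "Q > 0" using \<mu> by (simp add: Q_def)
  \<comment> \<open>Since \<open>1 / \<delta>\<close> is at least 1, rounding it up to
    \<open>N\<close> at most doubles it.\<close>
  have "\<delta> \<le> 1"
    using transverse_minimum_le_exp[OF v0 s, of \<Theta>] unfolding \<delta>_def \<mu>_def exp_minus by (simp add: field_simps)
  then have N1: "1 / \<delta> \<le> real N" "real N \<le> 2 / \<delta>" "N > 0"
  proof -
    have "1 / \<delta> \<ge> 1" using \<open>\<delta> \<le> 1\<close> \<delta> by simp
    moreover have "2 / \<delta> = 1 / \<delta> + 1 / \<delta>" by simp
    ultimately show "1 / \<delta> \<le> real N" "real N \<le> 2 / \<delta>" "N > 0"
      unfolding N_def by linarith+
  qed
  have K: "Q \<le> real K" "real K < Q + 1"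
    using Q unfolding K_def by linarith+
  define X :: "('m \<Rightarrow> nat) \<Rightarrow> real ^ 'm" where "X f = (\<chi> i. real (f i))" for f
  \<comment> \<open>The lattice point over the integer vector \<open>f\<close> whose last block is
    reduced into the half-open unit cube; \<open>cell\<close> then records which of \<open>N\<close>
    equal subintervals contains each of these coordinates.\<close>
  define p :: "('m \<Rightarrow> nat) \<Rightarrow> (real ^ 'm) \<times> (real ^ 'n)"
    where "p f = (X f, \<chi> j. frac (- ((\<Theta> *v X f) $ j)))" for f
  define cell :: "('m \<Rightarrow> nat) \<Rightarrow> 'n \<Rightarrow> nat" where "cell f = (\<lambda>j. nat \<lfloor>real N * snd (p f) $ j\<rfloor>)" for f
  define A where "A = (\<Pi>\<^sub>E i \<in> (UNIV :: 'm set). {..<K})"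
  define B where "B = (\<Pi>\<^sub>E j \<in> (UNIV :: 'n set). {..<N})"
  have p_lattice: "p f \<in> lattice_of \<Theta>" for f
    unfolding lattice_of_def p_def mem_Collect_eq
    by (intro exI[of _ "X f"] exI[of _ "\<chi> j. - of_int \<lfloor>- ((\<Theta> *v X f) $ j)\<rfloor>"])
      (auto simp: X_def vec_eq_iff frac_def)
  have p_inj: "p f = p g \<Longrightarrow> f = g" for f g
    by (auto simp: p_def X_def vec_eq_iff)
  \<comment> \<open>Integers in [0, K) differ by at most K - 1 < Q, and numbers in a common
    subinterval by less than 1/N, which is at most \<open>\<delta>\<close>.\<close>
  have close: "box_norm s (p f - p g) < \<mu>" if "f \<in> A" "g \<in> A" "cell f = cell g" for f g
    unfolding box_norm_less_iff
  proof (intro conjI allI)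
    fix i
    have "f i < K" "g i < K" using that by (auto simp: A_def PiE_iff)
    then have "\<bar>real (f i) - real (g i)\<bar> \<le> real K - 1" by linarith
    then show "\<bar>fst (p f - p g) $ i\<bar> < \<mu> * exp s"
      using K by (simp add: p_def X_def flip: Q_def)
  next
    fix j
    define a where "a = snd (p f) $ j"
    define b where "b = snd (p g) $ j"
    have "a \<ge> 0" "b \<ge> 0" by (auto simp: a_def b_def p_def)
    moreover have "nat \<lfloor>real N * a\<rfloor> = nat \<lfloor>real N * b\<rfloor>"
      using fun_cong[OF that(3), of j] by (simp add: cell_def a_def b_def)
    ultimately have "\<lfloor>real N * a\<rfloor> = \<lfloor>real N * b\<rfloor>"
      by (simp add: eq_nat_nat_iff)
    then have "\<bar>real N * a - real N * b\<bar> < 1" by linarith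
    then have "\<bar>(a - b) * real N\<bar> < 1" by (simp add: algebra_simps)
    then have "\<bar>a - b\<bar> * real N < 1" by (simp add: abs_mult)
    moreover have "1 \<le> \<delta> * real N" using N1(1) \<delta> by (simp add: field_simps)
    ultimately have "\<bar>a - b\<bar> * real N < \<delta> * real N" by linarith
    then have "\<bar>a - b\<bar> < \<delta>" using N1(3) by simp
    then show "\<bar>snd (p f - p g) $ j\<bar> < \<mu> * exp (- (real CARD('m) * s / real CARD('n)))"
      by (simp add: a_def b_def flip: \<delta>_def)
  qed
  \<comment> \<open>The points of a cell lie on a translate of the line through \<open>v\<close>.
    Their coefficients relative to \<open>p g\<close>, rescaled by \<open>box_norm s v / l\<close>,
    are 1-separated because distinct lattice points are at least \<open>l\<close> apart, and bounded
    by \<open>\<mu> / l\<close>.\<close>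
  have fibre: "real (card {f \<in> A. cell f = y}) \<le> 4 * (\<mu> / l)" for y
  proof (cases "{f \<in> A. cell f = y} = {}")
    case True
    then show ?thesis using \<mu> l by (simp only: card.empty) simp
  next
    case False
    then obtain g where g: "g \<in> A" "cell g = y" by blast
    have "\<exists>c. p f - p g = c *\<^sub>R v" if "f \<in> A" "cell f = y" for f
    proof -
      have "p f - p g \<in> span {v}"
      proof (rule ccontr)
        assume "p f - p g \<notin> span {v}"
        then have "\<mu> \<le> box_norm s (p f - p g)"
          unfolding \<mu>_def using diff_mem_lattice_of[OF p_lattice p_lattice]
          by (intro transverse_minimum_le) blast
        then show False using close[of f g] that g by simp
      qed
      then show ?thesis by (auto simp: span_singleton)
    qed
    then obtain c where c: "\<And>f. f \<in> A \<Longrightarrow> cell f = y \<Longrightarrow> p f - p g = c f *\<^sub>R v" by metis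
    have V: "box_norm s v > 0"
      using l first_minimum_le[OF v, of s] by (simp add: l_def)
    have cdiff: "\<bar>c f * (box_norm s v / l) - c f' * (box_norm s v / l)\<bar> = box_norm s (p f - p f') / l"
      if "f \<in> A" "cell f = y" "f' \<in> A" "cell f' = y" for f f'
    proof -
      have "p f - p f' = (c f - c f') *\<^sub>R v"
        using c[OF that(1,2)] c[OF that(3,4)] by (simp add: scaleR_diff_left algebra_simps)
      then have "box_norm s (p f - p f') / l = \<bar>c f - c f'\<bar> * \<bar>box_norm s v / l\<bar>"
        using l V by (simp add: box_norm_scaleR)
      then show ?thesis
        by (simp only: left_diff_distrib flip: abs_mult)
    qed
    have "c g = 0" using c[OF g] v0 by simp
    show ?thesis
    proof (rule card_le_of_separated_reals)
      fix f assume "f \<in> {f \<in> A. cell f = y}"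
      then show "\<bar>c f * (box_norm s v / l)\<bar> \<le> \<mu> / l"
        using cdiff[of f g] close[of f g] g \<open>c g = 0\<close> l by (simp add: divide_right_mono)
    next
      show "1 \<le> \<mu> / l" using l l\<mu> by simp
    next
      fix f f' assume f: "f \<in> {f \<in> A. cell f = y}" "f' \<in> {f \<in> A. cell f = y}" "f \<noteq> f'"
      then have "p f - p f' \<in> lattice_of \<Theta> - {0}"
        using p_inj[of f f'] diff_mem_lattice_of[OF p_lattice p_lattice] by auto
      then have "l \<le> box_norm s (p f - p f')"
        unfolding l_def by (rule first_minimum_le)
      then show "1 \<le> \<bar>c f * (box_norm s v / l) - c f' * (box_norm s v / l)\<bar>"
        using cdiff[of f f'] f l by simp
    qed
  qed
  have "cell ` A \<subseteq> B"
  proof clarsimp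
    fix f
    have "real N * frac a < real N" "0 \<le> real N * frac a" for a :: real
      using N1(3) frac_lt_1[of a] by auto
    then have "nat \<lfloor>real N * frac a\<rfloor> < N" for a :: real
      using N1(3) by (metis floor_less_iff nat_less_iff of_int_of_nat_eq zero_le_floor)
    then show "cell f \<in> B" by (auto simp: cell_def B_def p_def)
  qed
  then have "real (card A) \<le> real (card B) * (4 * (\<mu> / l))"
    by (intro card_le_card_times_fibre_bound[OF _ _ _ fibre]) (auto simp: A_def B_def intro: finite_PiE)
  then have "real K ^ CARD('m) \<le> real N ^ CARD('n) * (4 * (\<mu> / l))"
    by (simp add: A_def B_def card_PiE)
  moreover have "Q ^ CARD('m) \<le> real K ^ CARD('m)"
    using K Q by (intro power_mono) auto
  moreover have "real N ^ CARD('n) * (4 * (\<mu> / l)) \<le> (2 / \<delta>) ^ CARD('n) * (4 * (\<mu> / l))"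
    using N1 l \<mu> by (intro mult_right_mono power_mono) auto
  ultimately have "Q ^ CARD('m) \<le> (2 / \<delta>) ^ CARD('n) * (4 * (\<mu> / l))" by linarith
  then have "l * (Q ^ CARD('m) * \<delta> ^ CARD('n)) \<le> 2 ^ (CARD('n) + 2) * \<mu>"
    using l \<delta> by (simp add: field_simps power_divide power_add)
  \<comment> \<open>The exponentials cancel because all boxes have the same volume; dividing by
    \<open>\<mu>\<close> below leaves the exponent d - 1.\<close>
  also have "Q ^ CARD('m) * \<delta> ^ CARD('n) = \<mu> ^ (CARD('m) + CARD('n))"
    by (simp add: Q_def \<delta>_def power_mult_distrib power_add mult_exp_exp flip: exp_of_nat_mult)
  also have "CARD('m) + CARD('n) = Suc (CARD('m) + CARD('n) - 1)" by simp
  finally have "\<mu> * (l * \<mu> ^ (CARD('m) + CARD('n) - 1)) \<le> \<mu> * 2 ^ (CARD('n) + 2)"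
    by (simp only: power_Suc mult_ac)
  then show ?thesis
    using \<mu> unfolding l_def \<mu>_def by simp
qed

section \<open>Variation of the minima with the parameter\<close>

lemma transverse_minimum_forward:
  fixes \<Theta> :: "real ^ 'm ^ 'n"
  assumes "v \<noteq> 0" "h \<ge> 0"
  shows "transverse_minimum \<Theta> v (s + h) \<le> exp (real CARD('m) / real CARD('n) * h) * transverse_minimum \<Theta> v s"
proof -
  let ?e = "exp (real CARD('m) / real CARD('n) * h)"
  \<comment> \<open>Dividing first leaves the infimum alone on the right, so that the bound can be
    checked vector by vector.\<close>
  have "transverse_minimum \<Theta> v (s + h) / ?e \<le> transverse_minimum \<Theta> v s"
    unfolding transverse_minimum_def[of _ _ s]
  proof (rule cINF_greatest[OF lattice_minus_span_nonempty[OF assms(1)]])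
    fix w assume "w \<in> lattice_of \<Theta> - span {v}"
    then have "transverse_minimum \<Theta> v (s + h) \<le> box_norm (s + h) w"
      by (rule transverse_minimum_le)
    also have "\<dots> \<le> ?e * box_norm s w" by (rule box_norm_forward[OF assms(2)])
    finally show "transverse_minimum \<Theta> v (s + h) / ?e \<le> box_norm s w"
      by (simp add: pos_divide_le_eq mult.commute)
  qed
  then show ?thesis by (simp add: pos_divide_le_eq mult.commute)
qed

lemma transverse_minimum_backward:
  fixes \<Theta> :: "real ^ 'm ^ 'n"
  assumes "v \<noteq> 0" "h \<ge> 0"
  shows "transverse_minimum \<Theta> v s \<le> exp h * transverse_minimum \<Theta> v (s + h)"
proof -
  have "transverse_minimum \<Theta> v s / exp h \<le> transverse_minimum \<Theta> v (s + h)"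
    unfolding transverse_minimum_def[of _ _ "s + h"]
  proof (rule cINF_greatest[OF lattice_minus_span_nonempty[OF assms(1)]])
    fix w assume "w \<in> lattice_of \<Theta> - span {v}"
    then have "transverse_minimum \<Theta> v s \<le> box_norm s w"
      by (rule transverse_minimum_le)
    also have "\<dots> \<le> exp h * box_norm (s + h) w" by (rule box_norm_backward[OF assms(2)])
    finally show "transverse_minimum \<Theta> v s / exp h \<le> box_norm (s + h) w"
      by (simp add: pos_divide_le_eq mult.commute)
  qed
  then show ?thesis by (simp add: pos_divide_le_eq mult.commute)
qed

text \<open>Twice a positive infimum lies strictly above it. This avoids proving attainment, at the
  price of additive terms \<open>ln 2\<close> later.\<close>

lemma exists_almost_first_minimum:
  "\<exists>v \<in> lattice_of \<Theta> - {0}. box_norm s v \<le> 2 * first_minimum \<Theta> s"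
proof -
  have "(INF w \<in> lattice_of \<Theta> - {0}. box_norm s w) < 2 * first_minimum \<Theta> s"
    using first_minimum_pos[of \<Theta> s] unfolding first_minimum_def by linarith
  then show ?thesis
    using cINF_less_iff[OF lattice_minus_zero_nonempty bdd_below_box_norm] less_imp_le by blast
qed

text \<open>At \<open>s\<close>, a nonzero lattice vector \<open>c *\<^sub>R v\<close> is at least
  half as long as \<open>v\<close>, so |c| is at least 1/2, which persists at every
  \<open>u\<close>. Lattice vectors off the line are covered by the transverse minimum.\<close>

lemma first_minimum_ge_min:
  assumes v: "v \<in> lattice_of \<Theta> - {0}" "box_norm s v \<le> 2 * first_minimum \<Theta> s"
  shows "min (box_norm u v / 2) (transverse_minimum \<Theta> v u) \<le> first_minimum \<Theta> u"
  unfolding first_minimum_def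
proof (rule cINF_greatest[OF lattice_minus_zero_nonempty])
  fix w assume w: "w \<in> lattice_of \<Theta> - {0}"
  show "min (box_norm u v / 2) (transverse_minimum \<Theta> v u) \<le> box_norm u w"
  proof (cases "w \<in> span {v}")
    case False
    then show ?thesis using w transverse_minimum_le[of w \<Theta> v u] by auto
  next
    case True
    then obtain c where c: "w = c *\<^sub>R v" by (auto simp: span_singleton)
    have "box_norm s v \<le> 2 * (\<bar>c\<bar> * box_norm s v)"
      using v(2) first_minimum_le[OF w, of s] by (simp add: c box_norm_scaleR)
    moreover have "box_norm s v > 0"
      using first_minimum_pos[of \<Theta> s] first_minimum_le[OF v(1), of s] by linarith
    ultimately have "1 / 2 \<le> \<bar>c\<bar>" by simp
    then have "1 / 2 * box_norm u v \<le> \<bar>c\<bar> * box_norm u v"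
      by (rule mult_right_mono) (rule box_norm_nonneg)
    then show ?thesis by (simp add: c box_norm_scaleR)
  qed
qed

section \<open>Bounding the sum of the first two logarithmic minima\<close>

text \<open>\<open>S\<close> stands for V s + M s, and \<open>t\<close> for the meeting point to the
  right of s = t - h. The two denominators add up to d - 2, so \<open>D\<close> is positive and at
  least half of that. If n - 1 + nP is the larger, a combination of \<open>A\<close> and
  \<open>B\<close> is used; otherwise \<open>A\<close> alone suffices, since then 2P is below m/n -
  1 and (d - 2)/D is at most 2.\<close>

lemma weighted_bound_growing:
  fixes m n P S t h E :: real
  defines "D \<equiv> max (n - 1 + n * P) (m - 1 - n * P)"
  assumes mn: "m \<ge> 1" "n \<ge> 1" "m + n \<ge> 3" and P: "-1 \<le> P" "P \<le> 0" and h: "0 \<le> h" "h \<le> t"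
    and A: "S \<le> 2 * P * t - (m / n - 1) * h + E"
    and B: "(m + n - 1) * S \<le> (m + n - 2) * (P * t - m / n * h) + (m + n - 1) * E"
  shows "S \<le> (m + n - 2) * P / D * (t - h) + E"
proof (cases "m - 1 - n * P \<le> n - 1 + n * P")
  case True
  define q where "q = m / n"
  have nq: "n * q = m" using mn by (simp add: q_def)
  have D: "D = n - 1 + n * P" using True by (simp add: D_def)
  have D0: "D > 0" using True mn unfolding D by linarith
  have nP: "n * P \<le> 0" using mn P by (simp add: mult_nonneg_nonpos)
  have nn: "0 \<le> 2 * D - (m + n - 2)" using True D by linarith
  \<comment> \<open>The weights of \<open>A\<close> and \<open>B\<close> are chosen so that the
    combined right-hand side involves \<open>t\<close> and \<open>h\<close> only through t - h,
    while \<open>S\<close> receives the coefficient \<open>(m + n) * D\<close>.\<close>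
  have "(m + n - 2) * (m - n * P) * S \<le> (m + n - 2) * (m - n * P) * (2 * P * t - (q - 1) * h + E)"
    using A mn nP unfolding q_def by (intro mult_left_mono) auto
  moreover have "(2 * D - (m + n - 2)) * ((m + n - 1) * S)
      \<le> (2 * D - (m + n - 2)) * ((m + n - 2) * (P * t - q * h) + (m + n - 1) * E)"
    using B nn unfolding q_def by (intro mult_left_mono) auto
  ultimately have "(m + n - 2) * (m - n * P) * S + (2 * D - (m + n - 2)) * ((m + n - 1) * S) \<le>
      (m + n - 2) * (m - n * P) * (2 * P * t - (q - 1) * h + E) +
      (2 * D - (m + n - 2)) * ((m + n - 2) * (P * t - q * h) + (m + n - 1) * E)"
    by linarith
  moreover have "(m + n - 2) * (m - n * P) * S + (2 * D - (m + n - 2)) * ((m + n - 1) * S) = (m + n) * (D * S)"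
    unfolding D by (simp add: algebra_simps)
  moreover have "(m + n - 2) * (m - n * P) * (2 * P * t - (q - 1) * h + E) +
      (2 * D - (m + n - 2)) * ((m + n - 2) * (P * t - q * h) + (m + n - 1) * E)
     = (m + n) * ((m + n - 2) * P * (t - h) + D * E)"
    unfolding D nq[symmetric] by algebra
  ultimately have "(m + n) * (D * S) \<le> (m + n) * ((m + n - 2) * P * (t - h) + D * E)" by simp
  then have "D * S \<le> (m + n - 2) * P * (t - h) + D * E" using mn by simp
  then show ?thesis using D0 by (simp add: field_simps)
next
  case False
  have D: "D = m - 1 - n * P" using False by (simp add: D_def)
  have D0: "D > 0" "m + n - 2 \<le> 2 * D" using False mn D by linarith+
  have "2 * P \<le> m / n - 1" using False mn by (simp add: field_simps)
  then have "2 * P * h \<le> (m / n - 1) * h" using h(1) by (rule mult_right_mono)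
  then have "S \<le> 2 * P * (t - h) + E" using A by (simp add: algebra_simps)
  moreover have "2 * P * (t - h) \<le> (m + n - 2) / D * (P * (t - h))"
  proof -
    have "(m + n - 2) / D \<le> 2" using D0 by (simp add: field_simps)
    moreover have "P * (t - h) \<le> 0" using P h by (simp add: mult_nonpos_nonneg)
    ultimately show ?thesis using mult_right_mono_neg by (simp only: mult.assoc)
  qed
  ultimately show ?thesis by simp
qed

text \<open>The mirror case: the meeting point \<open>t\<close> lies to the left of s = t + h, and
  the two denominators exchange their roles.\<close>

lemma weighted_bound_shrinking:
  fixes m n P S t h E :: real
  defines "D \<equiv> max (n - 1 + n * P) (m - 1 - n * P)"
  assumes mn: "m \<ge> 1" "n \<ge> 1" "m + n \<ge> 3" and P: "-1 \<le> P" "P \<le> 0" and h: "0 \<le> h" "0 \<le> t"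
    and A: "S \<le> 2 * P * t + (m / n - 1) * h + E"
    and B: "(m + n - 1) * S \<le> (m + n - 2) * (P * t - h) + (m + n - 1) * E"
  shows "S \<le> (m + n - 2) * P / D * (t + h) + E"
proof (cases "n - 1 + n * P \<le> m - 1 - n * P")
  case True
  define q where "q = m / n"
  have nq: "n * q = m" using mn by (simp add: q_def)
  have D: "D = m - 1 - n * P" using True by (simp add: D_def)
  have D0: "D > 0" using True mn unfolding D by linarith
  \<comment> \<open>The weight of \<open>A\<close> contains n(1 + P), nonnegative by the lower bound
    on \<open>P\<close>.\<close>
  have nP: "n + n * P \<ge> 0" using mn P by (simp flip: distrib_left[of n 1 P, simplified])
  have nn: "0 \<le> 2 * D - (m + n - 2)" using True D by linarith
  have "(m + n - 2) * (n + n * P) * S \<le> (m + n - 2) * (n + n * P) * (2 * P * t + (q - 1) * h + E)"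
    using A mn nP unfolding q_def by (intro mult_left_mono) auto
  moreover have "(2 * D - (m + n - 2)) * ((m + n - 1) * S)
      \<le> (2 * D - (m + n - 2)) * ((m + n - 2) * (P * t - h) + (m + n - 1) * E)"
    using B nn by (intro mult_left_mono) auto
  ultimately have "(m + n - 2) * (n + n * P) * S + (2 * D - (m + n - 2)) * ((m + n - 1) * S) \<le>
      (m + n - 2) * (n + n * P) * (2 * P * t + (q - 1) * h + E) +
      (2 * D - (m + n - 2)) * ((m + n - 2) * (P * t - h) + (m + n - 1) * E)"
    by linarith
  moreover have "(m + n - 2) * (n + n * P) * S + (2 * D - (m + n - 2)) * ((m + n - 1) * S) = (m + n) * (D * S)"
    unfolding D by (simp add: algebra_simps)
  moreover have "(m + n - 2) * (n + n * P) * (2 * P * t + (q - 1) * h + E) +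
      (2 * D - (m + n - 2)) * ((m + n - 2) * (P * t - h) + (m + n - 1) * E)
     = (m + n) * ((m + n - 2) * P * (t + h) + D * E)"
    unfolding D nq[symmetric] by algebra
  ultimately have "(m + n) * (D * S) \<le> (m + n) * ((m + n - 2) * P * (t + h) + D * E)" by simp
  then have "D * S \<le> (m + n - 2) * P * (t + h) + D * E" using mn by simp
  then show ?thesis using D0 by (simp add: field_simps)
next
  case False
  have D: "D = n - 1 + n * P" using False by (simp add: D_def)
  have D0: "D > 0" "m + n - 2 \<le> 2 * D" using False mn D by linarith+
  have "m / n - 1 \<le> 2 * P" using False mn by (simp add: field_simps)
  then have "(m / n - 1) * h \<le> 2 * P * h" using h(1) by (rule mult_right_mono)
  then have "S \<le> 2 * P * (t + h) + E" using A by (simp add: algebra_simps)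
  moreover have "2 * P * (t + h) \<le> (m + n - 2) / D * (P * (t + h))"
  proof -
    have "(m + n - 2) / D \<le> 2" using D0 by (simp add: field_simps)
    moreover have "P * (t + h) \<le> 0" using P h by (simp add: mult_nonpos_nonneg)
    ultimately show ?thesis using mult_right_mono_neg by (simp only: mult.assoc)
  qed
  ultimately show ?thesis by simp
qed

text \<open>Supplies the continuity for the intermediate value theorem; \<open>q + 1\<close>
  dominates the slopes in both directions.\<close>

lemma continuous_on_of_bounded_slopes:
  fixes f :: "real \<Rightarrow> real"
  assumes q: "q \<ge> 0" and up: "\<And>u h. h \<ge> 0 \<Longrightarrow> f (u + h) \<le> f u + q * h"
    and down: "\<And>u h. h \<ge> 0 \<Longrightarrow> f u \<le> f (u + h) + h"
  shows "continuous_on X f"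
proof -
  have *: "\<bar>f x - f y\<bar> \<le> (q + 1) * \<bar>x - y\<bar>" if "x \<le> y" for x y
  proof -
    have "0 \<le> q * (y - x)" using q that by simp
    then show ?thesis
      using up[of "y - x" x] down[of "y - x" x] that by (simp add: algebra_simps)
  qed
  have "(q + 1)-lipschitz_on X f"
  proof (rule lipschitz_onI)
    fix x y
    show "dist (f x) (f y) \<le> (q + 1) * dist x y"
      using *[of x y] *[of y x] by (cases "x \<le> y") (auto simp: dist_real_def abs_minus_commute)
  qed (use q in simp)
  then show ?thesis by (rule lipschitz_on_continuous_on)
qed

text \<open>
  \<open>L\<close>, \<open>V\<close>, \<open>M\<close> stand for the logarithms of the first minimum, of the norm of an almost minimal
  vector at \<open>s\<close>, and of the transverse minimum. Moving from \<open>s\<close> in the direction in which \<open>V\<close> grows,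
  one reaches a point \<open>t\<close> with \<open>V t = M t\<close> up to \<open>a\<close>, where the hypothesis on \<open>L\<close> bounds both.
\<close>
lemma second_sum_bound:
  fixes L V M :: "real \<Rightarrow> real" and m n P T s a C\<^sub>0 C\<^sub>1 K :: real
  defines "D \<equiv> max (n - 1 + n * P) (m - 1 - n * P)"
  assumes mn: "m \<ge> 1" "n \<ge> 1" "m + n \<ge> 3" and P: "-1 \<le> P" "P \<le> 0" and T: "0 \<le> T" "T \<le> s"
    and nonneg: "a \<ge> 0" "C\<^sub>0 \<ge> 0" "C\<^sub>1 \<ge> 0" "K \<ge> 0"
    and M_up: "\<And>u h. h \<ge> 0 \<Longrightarrow> M (u + h) \<le> M u + m / n * h"
    and M_down: "\<And>u h. h \<ge> 0 \<Longrightarrow> M u \<le> M (u + h) + h"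
    and V_up: "\<And>u h. h \<ge> 0 \<Longrightarrow> V (u + h) \<le> V u + m / n * h"
    and V_down: "\<And>u h. h \<ge> 0 \<Longrightarrow> V u \<le> V (u + h) + h"
    and V_s: "(\<forall>h\<ge>0. V (s + h) = V s + m / n * h) \<or> (\<forall>h\<ge>0. V (s - h) = V s + h)"
    and L_ge: "\<And>u. u \<ge> 0 \<Longrightarrow> min (V u - a) (M u) \<le> L u"
    and VM: "V s \<le> M s + a"
    and L_le: "\<And>u. u \<ge> 0 \<Longrightarrow> L u \<le> C\<^sub>0"
    and mink: "V s + (m + n - 1) * M s \<le> C\<^sub>1"
    and L_P: "\<And>t. t \<ge> T \<Longrightarrow> L t \<le> P * t + K"
  shows "V s + M s \<le> (m + n - 2) * P / D * s + (2 * K + 3 * a + C\<^sub>0 + C\<^sub>1 + T)"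
proof -
  \<comment> \<open>Bounded errors: \<open>K + a\<close> for each of V and M at the meeting point,
    and \<open>C\<^sub>1\<close> from the Minkowski bound.\<close>
  define E where "E = 2 * (K + a) + C\<^sub>1"
  have q: "m / n > 0" using mn by simp
  have cont: "continuous_on X (\<lambda>u. M u - V u)" for X
    using q by (intro continuous_on_diff continuous_on_of_bounded_slopes[of "m / n"] M_up M_down V_up V_down) auto
  have E: "C\<^sub>1 + (m + n - 2) * (K + a) \<le> (m + n - 1) * E"
  proof -
    have "C\<^sub>1 \<le> (m + n - 1) * C\<^sub>1" using mn nonneg by (intro mult_le_cancel_right1[THEN iffD2]) auto
    moreover have "(m + n - 2) * (K + a) \<le> (m + n - 1) * (2 * (K + a))"
      using mn nonneg by (intro mult_mono) auto
    ultimately show ?thesis unfolding E_def by (simp add: algebra_simps)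
  qed
  \<comment> \<open>Splitting off the Minkowski expression turns an upper bound on V s into the
    hypothesis \<open>B\<close> of the weighted bounds.\<close>
  have S: "(m + n - 1) * (V s + M s) \<le> (m + n - 2) * x + (m + n - 1) * E" if "V s \<le> x + (K + a)" for x
  proof -
    have "(m + n - 1) * (V s + M s) = (m + n - 2) * V s + (V s + (m + n - 1) * M s)"
      by (simp add: algebra_simps)
    also have "\<dots> \<le> (m + n - 2) * (x + (K + a)) + C\<^sub>1"
      using mink mn that by (intro add_mono mult_left_mono) auto
    also have "\<dots> \<le> (m + n - 2) * x + (m + n - 1) * E"
      using E by (simp add: algebra_simps)
    finally show ?thesis .
  qed
  have V_meet: "V t \<le> P * t + (K + a)" if "t \<ge> T" "V t \<le> M t + a" for t
    using L_ge[of t] L_P[of t] that T by auto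
  from V_s show ?thesis
  proof
    assume V: "\<forall>h\<ge>0. V (s + h) = V s + m / n * h"
    have "\<exists>t\<ge>s. M t \<le> V t \<and> V t \<le> M t + a"
    proof (cases "M s \<le> V s")
      case True
      then show ?thesis using VM by blast
    next
      case False
      \<comment> \<open>So far to the right, V exceeds \<open>C\<^sub>0 + a\<close>. As the minimum
        of V - a and M is at most \<open>C\<^sub>0\<close>, M must have fallen below V, hence a
        crossing in between.\<close>
      define h where "h = max 0 ((C\<^sub>0 + a + 1 - V s) / (m / n))"
      have h: "h \<ge> 0" by (simp add: h_def)
      have "(C\<^sub>0 + a + 1 - V s) / (m / n) \<le> h" by (simp add: h_def)
      then have "C\<^sub>0 + a + 1 \<le> V (s + h)"
        using V h q by (simp only: pos_divide_le_eq[OF q]) (simp add: mult.commute)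
      then have "M (s + h) - V (s + h) \<le> 0"
        using L_ge[of "s + h"] L_le[of "s + h"] T h nonneg by linarith
      then have "\<exists>t\<ge>s. t \<le> s + h \<and> M t - V t = 0"
        using False h by (intro IVT2' cont) auto
      then show ?thesis using nonneg by force
    qed
    then obtain t where t: "t \<ge> s" "M t \<le> V t" "V t \<le> M t + a" by blast
    have Vt: "V t = V s + m / n * (t - s)" using V[rule_format, of "t - s"] t(1) by simp
    have Ms: "M s \<le> M t + (t - s)" using M_down[of "t - s" s] t by simp
    have Vle: "V t \<le> P * t + (K + a)" using V_meet t T by simp
    have "V s + M s \<le> (m + n - 2) * P / D * (t - (t - s)) + E"
      unfolding D_def
    proof (rule weighted_bound_growing[OF mn P])
      show "V s + M s \<le> 2 * P * t - (m / n - 1) * (t - s) + E"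
      proof -
        have "V s + M s \<le> 2 * (P * t) - m / n * (t - s) + (t - s) + E"
          using Vt Ms Vle t(2) nonneg unfolding E_def by argo
        then show ?thesis by (simp add: left_diff_distrib)
      qed
      show "(m + n - 1) * (V s + M s) \<le> (m + n - 2) * (P * t - m / n * (t - s)) + (m + n - 1) * E"
        using Vt Vle by (intro S) linarith
    qed (use t T in auto)
    then show ?thesis using nonneg T by (simp add: E_def)
  next
    assume V: "\<forall>h\<ge>0. V (s - h) = V s + h"
    \<comment> \<open>Leftwards the search ends at \<open>T\<close>, from which on the linear bound
      on L is assumed. If V is still below M there, V T is bounded, and slope -1 makes V s about
      -s.\<close>
    consider (meet) t where "T \<le> t" "t \<le> s" "M t \<le> V t" "V t \<le> M t + a" | (no_meet) "M T > V T"
    proof (cases "M T > V T")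
      case False
      show ?thesis
      proof (cases "M s \<le> V s")
        case True
        then show ?thesis using VM T meet by blast
      next
        case M: False
        have "\<exists>t\<ge>T. t \<le> s \<and> M t - V t = 0"
          using False M T by (intro IVT' cont) auto
        then show ?thesis using nonneg meet by force
      qed
    qed (use no_meet in blast)
    then show ?thesis
    proof cases
      case (meet t)
      have Vt: "V t = V s + (s - t)" using V[rule_format, of "s - t"] meet by simp
      have Ms: "M s \<le> M t + m / n * (s - t)" using M_up[of "s - t" t] meet by simp
      have Vle: "V t \<le> P * t + (K + a)" using V_meet meet by simp
      have "V s + M s \<le> (m + n - 2) * P / D * (t + (s - t)) + E"
        unfolding D_def
      proof (rule weighted_bound_shrinking[OF mn P])
        show "V s + M s \<le> 2 * P * t + (m / n - 1) * (s - t) + E"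
        proof -
          have "V s + M s \<le> 2 * (P * t) + m / n * (s - t) - (s - t) + E"
            using Vt Ms Vle meet(3) nonneg unfolding E_def by argo
          then show ?thesis by (simp add: left_diff_distrib)
        qed
        show "(m + n - 1) * (V s + M s) \<le> (m + n - 2) * (P * t - (s - t)) + (m + n - 1) * E"
          using Vt Vle by (intro S) linarith
      qed (use meet T in auto)
      then show ?thesis using nonneg T by (simp add: E_def)
    next
      case no_meet
      have "V T = V s + (s - T)" using V[rule_format, of "s - T"] T by simp
      moreover have "V T \<le> C\<^sub>0 + a" using L_ge[of T] L_le[of T] no_meet T nonneg by linarith
      ultimately have Vs: "V s \<le> - s + (C\<^sub>0 + a + T)" by linarith
      have Dpos: "D > 0" using mn unfolding D_def less_max_iff_disj by linarith
      have d: "m + n - 1 > 0" "m + n - 2 > 0" using mn by auto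
      \<comment> \<open>The difference between m - 1 - nP and the left side is (m - 1)(1 + P). Hence
        the slope -1 of V is at most (d - 1)P/D, which the Minkowski bound turns into the claimed
        slope.\<close>
      have "- (m + n - 1) * P \<le> D"
      proof -
        have "0 \<le> (m - 1) * (1 + P)" using mn P by simp
        then have "- (m + n - 1) * P \<le> m - 1 - n * P" by (simp add: algebra_simps)
        then show ?thesis by (simp add: D_def)
      qed
      then have "- s * D \<le> (m + n - 1) * P * s"
        using T mult_right_mono[of "- (m + n - 1) * P" D s] by (simp add: algebra_simps)
      define w where "w = P / D * s"
      have F: "- s \<le> (m + n - 1) * w"
        using \<open>- s * D \<le> (m + n - 1) * P * s\<close> Dpos by (simp add: w_def field_simps)
      have "(m + n - 1) * (V s + M s) = (m + n - 2) * V s + (V s + (m + n - 1) * M s)"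
        by (simp add: algebra_simps)
      also have "\<dots> \<le> (m + n - 2) * ((m + n - 1) * w + (C\<^sub>0 + a + T)) + C\<^sub>1"
        using mink d Vs F by (intro add_mono mult_left_mono) auto
      also have "\<dots> \<le> (m + n - 1) * ((m + n - 2) * w + (C\<^sub>0 + a + T) + C\<^sub>1)"
      proof -
        have "(m + n - 2) * (C\<^sub>0 + a + T) \<le> (m + n - 1) * (C\<^sub>0 + a + T)"
          using d nonneg T by (intro mult_right_mono) auto
        moreover have "1 * C\<^sub>1 \<le> (m + n - 1) * C\<^sub>1"
          using mn nonneg by (intro mult_right_mono) auto
        ultimately show ?thesis by (simp add: algebra_simps)
      qed
      finally have "V s + M s \<le> (m + n - 2) * w + (C\<^sub>0 + a + T) + C\<^sub>1"
        using d by simp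
      then show ?thesis using nonneg by (simp add: w_def)
    qed
  qed
qed

section \<open>The Schmidt exponents\<close>

text \<open>A weak form of Minkowski's first theorem: if the first minimum exceeds 1, so does the
  transverse one, and its power only enlarges the product already bounded.\<close>

lemma ln_first_minimum_le:
  fixes \<Theta> :: "real ^ 'm ^ 'n"
  assumes "s \<ge> 0"
  shows "ln (first_minimum \<Theta> s) \<le> (real CARD('n) + 2) * ln 2"
proof -
  define l where "l = first_minimum \<Theta> s"
  obtain v where v: "v \<in> lattice_of \<Theta> - {0}" using lattice_minus_zero_nonempty[of \<Theta>] by blast
  have l: "l > 0" "l \<le> transverse_minimum \<Theta> v s"
    using v first_minimum_pos[of \<Theta> s] first_minimum_le_transverse[of v \<Theta> s] by (auto simp: l_def)
  have "l \<le> 2 ^ (CARD('n) + 2)"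
  proof (cases "l \<le> 1")
    case True
    then show ?thesis by (rule order_trans) (rule one_le_power, simp)
  next
    case False
    then have "l * 1 \<le> l * transverse_minimum \<Theta> v s ^ (CARD('m) + CARD('n) - 1)"
      using l by (intro mult_left_mono one_le_power) auto
    also have "\<dots> \<le> 2 ^ (CARD('n) + 2)"
      unfolding l_def by (rule first_minimum_times_transverse_minimum_power_le[OF v assms])
    finally show ?thesis by simp
  qed
  then have "ln l \<le> ln (2 ^ (CARD('n) + 2))" using l by simp
  then show ?thesis by (simp only: ln_realpow l_def[symmetric]) (simp add: add.commute)
qed

lemma ln_minima_sum_le:
  fixes \<Theta> :: "real ^ 'm ^ 'n"
  defines "m \<equiv> real CARD('m)" and "n \<equiv> real CARD('n)"
  assumes d: "m + n \<ge> 3" and P: "-1 \<le> P" "P \<le> 0" and T: "0 \<le> T" "T \<le> s" and K: "K \<ge> 0"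
    and L: "\<And>t. t \<ge> T \<Longrightarrow> ln (first_minimum \<Theta> t) \<le> P * t + K"
  shows "ln (first_minimum \<Theta> s) + ln (successive_minimum 2 (box_body s) (lattice_of \<Theta>))
    \<le> (m + n - 2) * P / max (n - 1 + n * P) (m - 1 - n * P) * s
       + (2 * K + 3 * ln 2 + (n + 2) * ln 2 + (n + 3) * ln 2 + T + ln 2)"
proof -
  have mn: "m \<ge> 1" "n \<ge> 1" by (simp_all add: m_def n_def Suc_leI)
  obtain v where v: "v \<in> lattice_of \<Theta> - {0}" "box_norm s v \<le> 2 * first_minimum \<Theta> s"
    using exists_almost_first_minimum by blast
  define L where "L u = ln (first_minimum \<Theta> u)" for u
  define V where "V u = ln (box_norm u v)" for u
  define M where "M u = ln (transverse_minimum \<Theta> v u)" for u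
  have v0: "v \<noteq> 0" using v by simp
  have s: "s \<ge> 0" using T by simp
  note pos = first_minimum_pos[of \<Theta>] transverse_minimum_pos[OF v0, of \<Theta>]
  have Npos: "box_norm u v > 0" for u
    using pos(1)[of u] first_minimum_le[OF v(1), of u] by linarith
  have VM: "V s \<le> ln 2 + L s"
    using v(2) pos(1)[of s] Npos[of s] unfolding V_def L_def by (simp flip: ln_mult_pos)
  have LV: "L s \<le> V s"
    using first_minimum_le[OF v(1), of s] pos(1)[of s] Npos[of s] by (simp add: L_def V_def)
  have LM: "L s \<le> M s"
    using first_minimum_le_transverse[OF v0, of \<Theta> s] pos[of s] by (simp add: L_def M_def)
  have "V s + M s \<le> (m + n - 2) * P / max (n - 1 + n * P) (m - 1 - n * P) * s
       + (2 * K + 3 * ln 2 + (n + 2) * ln 2 + (n + 3) * ln 2 + T)"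
  \<comment> \<open>Here \<open>a\<close> is \<open>ln 2\<close>, from almost minimality of
    \<open>v\<close>; \<open>C\<^sub>1\<close> exceeds \<open>C\<^sub>0\<close> by
    \<open>ln 2\<close> because V s replaces L s in the Minkowski bound.\<close>
  proof (rule second_sum_bound[OF mn d P T, where L = L])
    fix u h :: real assume h: "h \<ge> 0"
    have "M (u + h) \<le> ln (exp (m / n * h) * transverse_minimum \<Theta> v u)"
      using transverse_minimum_forward[OF v0 h, of \<Theta> u] pos(2)[of "u + h"] unfolding M_def m_def n_def by simp
    then show "M (u + h) \<le> M u + m / n * h"
      using pos(2)[of u] by (simp add: M_def ln_mult)
    have "M u \<le> ln (exp h * transverse_minimum \<Theta> v (u + h))"
      using transverse_minimum_backward[OF v0 h, of \<Theta> u] pos(2)[of u] unfolding M_def by simp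
    then show "M u \<le> M (u + h) + h"
      using pos(2)[of "u + h"] by (simp add: M_def ln_mult)
    have "V (u + h) \<le> ln (exp (m / n * h) * box_norm u v)"
      using box_norm_forward[OF h, of u v] Npos[of "u + h"] unfolding V_def m_def n_def by simp
    then show "V (u + h) \<le> V u + m / n * h"
      using Npos[of u] by (simp add: V_def ln_mult)
    have "V u \<le> ln (exp h * box_norm (u + h) v)"
      using box_norm_backward[OF h, of u v] Npos[of u] unfolding V_def by simp
    then show "V u \<le> V (u + h) + h"
      using Npos[of "u + h"] by (simp add: V_def ln_mult)
  next
    have "box_norm s v = exp (- s) * infnorm (fst v) \<or>
          box_norm s v = exp (real CARD('m) * s / real CARD('n)) * infnorm (snd v)"
      by (auto simp: box_norm_def)
    then show "(\<forall>h\<ge>0. V (s + h) = V s + m / n * h) \<or> (\<forall>h\<ge>0. V (s - h) = V s + h)"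
    proof
      assume *: "box_norm s v = exp (- s) * infnorm (fst v)"
      have "V (s - h) = V s + h" if "h \<ge> 0" for h
      proof -
        have "box_norm (s - h) v = exp h * box_norm s v"
          using box_norm_fst_dominant_backward[of "s - h" h v] * that by simp
        then show ?thesis using Npos[of s] by (simp add: V_def ln_mult)
      qed
      then show ?thesis by blast
    next
      assume *: "box_norm s v = exp (real CARD('m) * s / real CARD('n)) * infnorm (snd v)"
      have "V (s + h) = V s + m / n * h" if "h \<ge> 0" for h
        using box_norm_snd_dominant_forward[OF * that] Npos[of s] by (simp add: V_def ln_mult m_def n_def)
      then show ?thesis by blast
    qed
  next
    fix u :: real
    have "V u - ln 2 = ln (box_norm u v / 2)" using Npos[of u] by (simp add: V_def ln_div)
    then show "min (V u - ln 2) (M u) \<le> L u"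
      using first_minimum_ge_min[OF v, of u] Npos[of u] pos[of u]
      unfolding M_def L_def min_le_iff_disj by auto
  next
    show "V s \<le> M s + ln 2" using VM LM by simp
  next
    show "L u \<le> (n + 2) * ln 2" if "u \<ge> 0" for u
      using ln_first_minimum_le[OF that, of \<Theta>] by (simp add: L_def n_def)
  next
    have "L s + real (CARD('m) + CARD('n) - 1) * M s =
        ln (first_minimum \<Theta> s * transverse_minimum \<Theta> v s ^ (CARD('m) + CARD('n) - 1))"
      using pos[of s] by (simp add: L_def M_def ln_mult ln_realpow)
    also have "\<dots> \<le> ln (2 ^ (CARD('n) + 2))"
      using first_minimum_times_transverse_minimum_power_le[OF v(1) s] pos[of s]
      by (intro ln_mono) auto
    also have "\<dots> = (n + 2) * ln 2" by (simp only: ln_realpow) (simp add: n_def)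
    also have "real (CARD('m) + CARD('n) - 1) = m + n - 1"
      by (subst of_nat_diff) (simp_all add: m_def n_def Suc_le_eq)
    finally show "V s + (m + n - 1) * M s \<le> (n + 3) * ln 2"
      using VM by (simp add: algebra_simps)
  qed (use mn K L in \<open>auto simp: L_def\<close>)
  moreover have "ln (successive_minimum 2 (box_body s) (lattice_of \<Theta>)) \<le> M s + ln 2"
  proof -
    \<comment> \<open>The norm of \<open>v\<close> is at most twice the first minimum, hence at most
      twice the transverse one; this costs the last \<open>ln 2\<close>.\<close>
    have "successive_minimum 2 (box_body s) (lattice_of \<Theta>) \<le> 2 * transverse_minimum \<Theta> v s"
      using successive_minimum_2_pos_le(2)[OF v(1), of s] v(2) first_minimum_le_transverse[OF v0, of \<Theta> s] pos(2)[of s]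
      by linarith
    then have "ln (successive_minimum 2 (box_body s) (lattice_of \<Theta>)) \<le> ln (2 * transverse_minimum \<Theta> v s)"
      using successive_minimum_2_pos_le(1)[OF v(1), of s] by (intro ln_mono) auto
    then show ?thesis using pos(2)[of s] by (simp add: M_def ln_mult)
  qed
  ultimately show ?thesis using LV by (simp add: L_def)
qed

section \<open>Passage to the upper limits\<close>

lemma eventually_upper_bound_divided:
  fixes f :: "real \<Rightarrow> real"
  assumes "\<And>s. s \<ge> T \<Longrightarrow> f s \<le> c * s + C"
  shows "Limsup at_top (\<lambda>s. ereal (f s / s)) \<le> ereal c"
proof -
  have "Limsup at_top (\<lambda>s. ereal (f s / s)) \<le> Limsup at_top (\<lambda>s. ereal (c + C / s))"
  proof (rule Limsup_mono)
    show "\<forall>\<^sub>F s in at_top. ereal (f s / s) \<le> ereal (c + C / s)"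
      using eventually_ge_at_top[of "max T 1"]
    proof eventually_elim
      case (elim s)
      then have "f s / s \<le> (c * s + C) / s" using assms[of s] by (intro divide_right_mono) auto
      then show ?case using elim by (simp add: add_divide_distrib)
    qed
  qed
  also have "\<dots> = ereal c"
  proof (rule lim_imp_Limsup)
    have "((\<lambda>s. c + C / s) \<longlongrightarrow> c + 0) at_top"
      by (intro tendsto_intros tendsto_divide_0[OF tendsto_const]) (simp add: filterlim_ident filterlim_at_top_imp_at_infinity)
    then show "((\<lambda>s. ereal (c + C / s)) \<longlongrightarrow> ereal c) at_top" by simp
  qed simp
  finally show ?thesis .
qed

lemma Psi_fun_1: "Psi_fun \<Theta> 1 s = ln (first_minimum \<Theta> s) / s"
  by (simp add: Psi_fun_def psi_fun_def successive_minimum_1[unfolded One_nat_def])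

lemma Psi_fun_2:
  "Psi_fun \<Theta> 2 s =
     (ln (first_minimum \<Theta> s) + ln (successive_minimum 2 (box_body s) (lattice_of \<Theta>))) / s"
  by (simp add: Psi_fun_def psi_fun_def successive_minimum_1[unfolded One_nat_def] numeral_2_eq_2 add_divide_distrib)

text \<open>Finiteness allows real arithmetic from here on. The constant bound on the first minimum
  gives 0, its lower bound \<open>exp (- s)\<close> gives -1.\<close>

lemma upper_Schmidt_exponent_1_bounds:
  fixes \<Theta> :: "real ^ 'm ^ 'n"
  obtains r where "upper_Schmidt_exponent \<Theta> 1 = ereal r" "-1 \<le> r" "r \<le> 0"
proof -
  have "upper_Schmidt_exponent \<Theta> 1 \<le> ereal 0"
    unfolding upper_Schmidt_exponent_def Psi_fun_1
    by (rule eventually_upper_bound_divided[where T = 0]) (use ln_first_minimum_le[of _ \<Theta>] in simp)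
  moreover have "ereal (-1) \<le> upper_Schmidt_exponent \<Theta> 1"
    unfolding upper_Schmidt_exponent_def Psi_fun_1
  proof (rule le_Limsup)
    show "\<forall>\<^sub>F s in at_top. ereal (- 1) \<le> ereal (ln (first_minimum \<Theta> s) / s)"
      using eventually_ge_at_top[of 1]
    proof eventually_elim
      case (elim s)
      then have "- s \<le> ln (first_minimum \<Theta> s)"
        using exp_le_first_minimum[of s \<Theta>] first_minimum_pos[of \<Theta> s] by (subst ln_ge_iff) auto
      then show ?case using elim by (simp add: field_simps)
    qed
  qed simp
  ultimately show ?thesis
    using that by (cases "upper_Schmidt_exponent \<Theta> 1") auto
qed

text \<open>The maximum unites both cases of the theorem. The estimate at finite \<open>s\<close> is
  applied with a slope \<open>P\<close> slightly above \<open>r\<close>, unless \<open>r\<close> is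
  0, and continuity in \<open>P\<close> lets \<open>\<epsilon>\<close> tend to 0.\<close>

lemma upper_Schmidt_exponent_2_le:
  fixes \<Theta> :: "real ^ 'm ^ 'n"
  defines "m \<equiv> real CARD('m)" and "n \<equiv> real CARD('n)"
  assumes d: "m + n \<ge> 3" and r: "upper_Schmidt_exponent \<Theta> 1 = ereal r" "-1 \<le> r" "r \<le> 0"
  shows "upper_Schmidt_exponent \<Theta> 2
    \<le> ereal ((m + n - 2) * r / max (n - 1 + n * r) (m - 1 - n * r))"
proof -
  define F where "F P = (m + n - 2) * P / max (n - 1 + n * P) (m - 1 - n * P)" for P
  have le_F: "upper_Schmidt_exponent \<Theta> 2 \<le> ereal (F (min 0 (r + \<epsilon>)))" if "\<epsilon> > 0" for \<epsilon>
  proof -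
    \<comment> \<open>Truncation keeps \<open>P\<close> nonpositive; when
      \<open>r + \<epsilon>\<close> is positive, the constant bound \<open>K\<close> takes
      over.\<close>
    define P where "P = min 0 (r + \<epsilon>)"
    have P: "-1 \<le> P" "P \<le> 0" using that r by (auto simp: P_def)
    have "upper_Schmidt_exponent \<Theta> 1 < ereal (r + \<epsilon>)" using that r by simp
    then have "\<forall>\<^sub>F s in at_top. ereal (Psi_fun \<Theta> 1 s) < ereal (r + \<epsilon>)"
      unfolding upper_Schmidt_exponent_def by (rule Limsup_lessD)
    then obtain T where T: "\<And>s. s \<ge> T \<Longrightarrow> ln (first_minimum \<Theta> s) / s < r + \<epsilon>"
      unfolding eventually_at_top_linorder Psi_fun_1 by auto
    define K where "K = (n + 2) * ln 2"
    have K: "K \<ge> 0" by (simp add: K_def n_def)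
    have "ln (first_minimum \<Theta> t) \<le> P * t + K" if "t \<ge> max T 1" for t
    proof (cases "r + \<epsilon> \<le> 0")
      case True
      then show ?thesis
        using T[of t] that K by (simp add: P_def field_simps)
    next
      case False
      then show ?thesis
        using ln_first_minimum_le[of t \<Theta>] that by (simp add: P_def K_def n_def)
    qed
    note ln_minima_sum_le[where T = "max T 1", OF d[unfolded m_def n_def] P _ _ K this]
    then show ?thesis
      unfolding upper_Schmidt_exponent_def Psi_fun_2 P_def[symmetric] F_def m_def n_def
      by (rule eventually_upper_bound_divided[where T = "max T 1"]) auto
  qed
  have "((\<lambda>\<epsilon>. F (min 0 (r + \<epsilon>))) \<longlongrightarrow> F (min 0 (r + 0))) (at_right 0)"
  proof -
    \<comment> \<open>The two entries add up to m + n - 2, which is positive, so the larger one is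
      too.\<close>
    have "max (n - 1 + n * P) (m - 1 - n * P) \<noteq> 0" for P
      using d by linarith
    then show ?thesis unfolding F_def by (intro tendsto_intros)
  qed
  then have "((\<lambda>\<epsilon>. ereal (F (min 0 (r + \<epsilon>)))) \<longlongrightarrow> ereal (F r)) (at_right 0)"
    using r by simp
  moreover have "\<forall>\<^sub>F \<epsilon> in at_right 0. upper_Schmidt_exponent \<Theta> 2 \<le> ereal (F (min 0 (r + \<epsilon>)))"
    using eventually_at_right_less[of 0] by eventually_elim (rule le_F)
  ultimately show ?thesis
    unfolding F_def[symmetric] by (rule tendsto_lowerbound) simp
qed

theorem theorem5:
  fixes \<Theta> :: "real ^ 'm ^ 'n" and m n d :: nat and \<Psi>\<^sub>1 \<Psi>\<^sub>2 :: ereal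
  assumes "m = CARD('m)" and "n = CARD('n)" and "d = m + n" and "n + m \<ge> 3"
    and "\<Psi>\<^sub>1 = upper_Schmidt_exponent \<Theta> 1" and "\<Psi>\<^sub>2 = upper_Schmidt_exponent \<Theta> 2"
  shows "(\<Psi>\<^sub>1 \<ge> ereal ((real m - real n) / (2 * real n)) \<longrightarrow>
            \<Psi>\<^sub>2 \<le> (ereal (real d - 2) * \<Psi>\<^sub>1) / (ereal (real n - 1) + ereal (real n) * \<Psi>\<^sub>1)) \<and>
         (\<Psi>\<^sub>1 \<le> ereal ((real m - real n) / (2 * real n)) \<longrightarrow>
            \<Psi>\<^sub>2 \<le> (ereal (real d - 2) * \<Psi>\<^sub>1) / (ereal (real m - 1) - ereal (real n) * \<Psi>\<^sub>1))"
proof -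
  obtain r where r: "upper_Schmidt_exponent \<Theta> 1 = ereal r" "-1 \<le> r" "r \<le> 0"
    by (rule upper_Schmidt_exponent_1_bounds)
  have mn: "real m + real n \<ge> 3" "real n > 0" "real d = real m + real n"
    using assms(2-4) by auto
  have bound: "\<Psi>\<^sub>2 \<le> ereal ((real m + real n - 2) * r / max (real n - 1 + real n * r) (real m - 1 - real n * r))"
    using upper_Schmidt_exponent_2_le[OF _ r] mn(1) unfolding assms(1,2,6) by simp
  show ?thesis
  proof (intro conjI impI)
    assume "\<Psi>\<^sub>1 \<ge> ereal ((real m - real n) / (2 * real n))"
    \<comment> \<open>The threshold is the value of \<open>r\<close> at which the two denominators
      coincide, so it decides which one is the maximum.\<close>
    then have "real m - 1 - real n * r \<le> real n - 1 + real n * r"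
      using mn r assms(5) by (simp add: field_simps)
    \<comment> \<open>With a nonzero denominator, extended real division agrees with the real
      quotient in \<open>bound\<close>.\<close>
    moreover from this have "real n - 1 + real n * r \<noteq> 0" using mn by linarith
    ultimately show "\<Psi>\<^sub>2 \<le> (ereal (real d - 2) * \<Psi>\<^sub>1) / (ereal (real n - 1) + ereal (real n) * \<Psi>\<^sub>1)"
      using bound r assms(5) mn(3) by (simp add: max_absorb1)
  next
    assume "\<Psi>\<^sub>1 \<le> ereal ((real m - real n) / (2 * real n))"
    then have "real n - 1 + real n * r \<le> real m - 1 - real n * r"
      using mn r assms(5) by (simp add: field_simps)
    moreover from this have "real m - 1 - real n * r \<noteq> 0" using mn by linarith
    ultimately show "\<Psi>\<^sub>2 \<le> (ereal (real d - 2) * \<Psi>\<^sub>1) / (ereal (real m - 1) - ereal (real n) * \<Psi>\<^sub>1)"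
      using bound r assms(5) mn(3) by (simp add: max_absorb2)
  qed
qed

end
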